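(* Let $n\ge 2$ and let $B_n$ be the closed unit Euclidean ball in $\mathbb{R}^n$ centered at the origin. For any nondegenerate $n$-dimensional simplex $S\subset B_n$ there exists a vertex $g$ of $S$ with the following property: if $E$ is the minimal ellipsoid of $S$, $h$ is the center of gravity of the $(n-1)$-dimensional face of $S$ spanned by the remaining $n$ vertices, and $y$ is the intersection point of the straight line $(gh)$ with the boundary of $E$ in the direction from $g$ to $h$ (i.e. the point $g+t(h-g)$, $t>0$, on the boundary of $E$), then $y\in B_n$.
   Context: The minimal ellipsoid of a nondegenerate simplex $S$ is the (unique) ellipsoid of minimum volume containing $S$. The center of gravity of a face is the arithmetic mean of its vertices. *)

theory Defs
  imports "HOL-Analysis.Analysis"
begin

definition ellipsoid :: "(real ^ 'n) set \<Rightarrow> bool" where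
  "ellipsoid E \<longleftrightarrow>
     (\<exists>(A :: real ^ 'n ^ 'n) c. invertible A \<and> E = (\<lambda>x. c + A *v x) ` cball 0 1)"

definition minimal_ellipsoid :: "(real ^ 'n) set \<Rightarrow> (real ^ 'n) set \<Rightarrow> bool" where
  "minimal_ellipsoid S E \<longleftrightarrow>
     ellipsoid E \<and> S \<subseteq> E \<and>
     (\<forall>E'. ellipsoid E' \<and> S \<subseteq> E' \<longrightarrow> measure lebesgue E \<le> measure lebesgue E')"

definition vertices :: "'a::real_vector set \<Rightarrow> 'a set" where
  "vertices P = {v. v extreme_point_of P}"

definition opposite_face :: "'a::real_vector set \<Rightarrow> 'a \<Rightarrow> 'a set" where
  "opposite_face S g = convex hull (vertices S - {g})"

definition center_of_gravity :: "'a::real_vector set \<Rightarrow> 'a" where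
  "center_of_gravity F = (\<Sum>v\<in>vertices F. v) /\<^sub>R real (card (vertices F))"

end

theory Submission imports Defs begin

text \<open>
  In every minimal ellipsoid \<open>E\<close> of a simplex, the vertices lie on the boundary of \<open>E\<close> and the
  centre of \<open>E\<close> is the centroid \<open>c\<close> of the vertices. The line from a vertex \<open>g\<close> to the centre of
  gravity of the opposite face passes through \<open>c\<close>, so it leaves \<open>E\<close> at the antipode \<open>2c - g\<close> of
  \<open>g\<close>. Some antipode lies in the unit ball, because the squared norms have the same average before
  and after reflection in \<open>c\<close>:
  \<open>\<Sum>\<bar>2c - g\<bar>\<^sup>2 = 4N\<bar>c\<bar>\<^sup>2 - 4c \<bullet> \<Sum>g + \<Sum>\<bar>g\<bar>\<^sup>2 = \<Sum>\<bar>g\<bar>\<^sup>2 \<le> N\<close>, where \<open>N\<close> is the number of vertices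
  and \<open>\<Sum>g = Nc\<close> (lemma \<open>reflection_of_some_point_in_ball\<close>).

  The description of \<open>E\<close> (lemma \<open>minimal_ellipsoid_vertices_and_centre\<close>) comes from moving one vertex
  at a time. Let \<open>\<lambda>\<close> be the barycentric coordinate of the vertex \<open>k\<close>. For \<open>w \<in> E\<close> the affine map
  \<open>x \<mapsto> x + \<lambda>(x)(w - k)\<close> sends \<open>k\<close> to \<open>w\<close>, fixes the other vertices, and has determinant \<open>\<lambda>(w)\<close>.
  If \<open>\<lambda>(w) > 1\<close>, the preimage of \<open>E\<close> under it is an ellipsoid around the simplex of volume
  \<open>vol E / \<lambda>(w) < vol E\<close>. So minimality forces \<open>\<lambda>(w) \<le> 1 = \<lambda>(k)\<close>: the function \<open>\<lambda>\<close> attains its maximum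
  over \<open>E\<close> at \<open>k\<close> (lemma \<open>minimal_ellipsoid_supported_at_vertex\<close>). In coordinates in which \<open>E\<close> is
  the unit ball, this says that each vertex is a unit vector parallel to the gradient of its own
  barycentric coordinate. All inner products of two distinct vertices then agree, and the sum of
  the vertices vanishes (lemma \<open>supporting_barycentric_imp_regular\<close>).
\<close>

section \<open>Volume under rank-one perturbations of the identity\<close>

text \<open>
  A well-ordered copy of an arbitrary finite type. The transformation rule
  \<open>measure_linear_image\<close> refers to vectors with well-ordered indices, and relabelling the
  coordinates carries it over to all finite index types.
\<close>

typedef 'a index = "{..<CARD('a::finite)}"
  by (intro exI[of _ 0]) simp

instance index :: (finite) finite
proof
  have "finite (Rep_index ` (UNIV :: 'a index set))"
    by (rule finite_subset[of _ "{..<CARD('a)}"]) (use Rep_index in auto)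
  then show "finite (UNIV :: 'a index set)"
    by (rule finite_imageD) (auto simp: inj_on_def Rep_index_inject)
qed

instantiation index :: (finite) wellorder
begin
definition "i \<le> j \<longleftrightarrow> Rep_index i \<le> Rep_index j"
definition "i < j \<longleftrightarrow> Rep_index i < Rep_index j"
instance
proof
  fix P :: "'a index \<Rightarrow> bool" and i
  assume step: "\<And>i. (\<And>j. j < i \<Longrightarrow> P j) \<Longrightarrow> P i"
  show "P i"
  proof (induction i rule: measure_induct_rule[of Rep_index])
    case (less i)
    show ?case by (rule step) (simp add: less.IH less_index_def)
  qed
qed (auto simp: less_eq_index_def less_index_def Rep_index_inject)
end

lemma card_index: "CARD('a::finite index) = CARD('a)"
  using type_definition.card[OF type_definition_index] by simp

text \<open>
  A relabelling of the coordinates turns each box into a box with the same side lengths, and Lebesgue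
  measure is determined by its values on boxes.
\<close>
lemma reindex_measure_preserving:
  fixes p :: "'m::finite \<Rightarrow> 'n::finite" and K :: "(real^'n) set"
  defines "f \<equiv> \<lambda>x::real^'n. \<chi> i. x $ p i"
  assumes p: "bij p" and K: "compact K"
  shows "measure lebesgue (f ` K) = measure lebesgue K"
proof -
  define g where "g = (\<lambda>y::real^'m. \<chi> i. y $ inv p i)"
  have fg: "f (g y) = y" and gf: "g (f x) = x" for x y
    using p by (auto simp: f_def g_def vec_eq_iff bij_is_inj bij_is_surj surj_f_inv_f)
  have lin: "linear f"
    unfolding f_def by (rule linearI) (auto simp: vec_eq_iff)
  have cont: "continuous_on T f" for T
    using lin by (rule linear_continuous_on_compose[OF continuous_on_id, simplified])
  have distr: "lborel = distr lborel borel f"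
  proof (rule lborel_eqI)
    fix l u :: "real^'m"
    assume le: "\<And>b. b \<in> Basis \<Longrightarrow> l \<bullet> b \<le> u \<bullet> b"
    have le': "l $ i \<le> u $ i" for i
      using le[of "axis i 1"] by (simp add: axis_in_Basis_iff inner_axis)
    have vimage: "f -` box l u = box (g l) (g u)"
      unfolding f_def g_def using p
      by (auto simp: mem_box_cart)
        (metis bij_is_surj surj_f_inv_f bij_is_inj inv_f_f)+
    have "emeasure (distr lborel borel f) (box l u) = emeasure lborel (box (g l) (g u))"
      using vimage by (subst emeasure_distr) (auto intro!: borel_measurable_continuous_onI cont)
    also have "\<dots> = (\<Prod>b\<in>Basis. (g u - g l) \<bullet> b)"
      by (rule emeasure_lborel_box) (auto simp: g_def Basis_vec_def inner_axis le')
    also have "(\<Prod>b\<in>Basis. (g u - g l) \<bullet> b) = (\<Prod>i\<in>UNIV. (g u - g l) $ i)"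
      by (subst Basis_vec_def) (simp add: UNION_singleton_eq_range prod.reindex inj_on_def axis_eq_axis inner_axis)
    also have "\<dots> = (\<Prod>i\<in>UNIV. (u - l) $ inv p i)"
      by (simp add: g_def)
    also have "\<dots> = (\<Prod>i\<in>UNIV. (u - l) $ i)"
      by (rule prod.reindex_bij_betw[OF bij_imp_bij_inv[OF p]])
    also have "\<dots> = (\<Prod>b\<in>Basis. (u - l) \<bullet> b)"
      by (subst Basis_vec_def) (simp add: UNION_singleton_eq_range prod.reindex inj_on_def axis_eq_axis inner_axis)
    finally show "emeasure (distr lborel borel f) (box l u) = ennreal (\<Prod>b\<in>Basis. (u - l) \<bullet> b)" .
  qed simp
  have cfK: "compact (f ` K)"
    using K cont by (rule compact_continuous_image[rotated])
  have "measure lebesgue (f ` K) = measure lborel (f ` K)"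
    using cfK by (simp add: measure_completion borel_compact)
  also have "\<dots> = measure lborel (f -` (f ` K))"
    by (subst distr, subst measure_distr)
      (use cfK in \<open>auto intro!: borel_measurable_continuous_onI cont borel_compact\<close>)
  also have "f -` (f ` K) = K"
    using gf by (auto intro!: image_eqI) (metis gf)
  also have "measure lborel K = measure lebesgue K"
    using K by (simp add: measure_completion borel_compact)
  finally show ?thesis .
qed


text \<open>
  After a rotation \<open>u\<close> is a multiple of a basis vector, and the map changes only one row of
  the identity matrix; Cramer's rule evaluates such a determinant.
\<close>
lemma det_rank_one_update:
  fixes u v :: "real ^ 'n"
  shows "det (matrix (\<lambda>x. x + (v \<bullet> x) *\<^sub>R u)) = 1 + v \<bullet> u"
proof -
  let ?T = "\<lambda>x. x + (v \<bullet> x) *\<^sub>R u"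
  obtain k :: 'n where True by simp
  let ?a = "norm u *\<^sub>R axis k 1 :: real^'n"
  obtain f where orth: "orthogonal_transformation f" and fa: "f ?a = u"
    using orthogonal_transformation_exists[of ?a u] by auto
  obtain g where g: "orthogonal_transformation g" "f \<circ> g = id" "g \<circ> f = id"
    using orth orthogonal_transformation_inv orthogonal_transformation_bij bij_is_inj bij_is_surj
      surj_iff inj_iff by metis
  define r where "r = axis k 1 + norm u *\<^sub>R g v"
  let ?T' = "\<lambda>x. x + (g v \<bullet> x) *\<^sub>R ?a"
  have fg: "f (g x) = x" and gf: "g (f x) = x" for x
    using g(2,3) by (metis comp_apply id_apply)+
  have lin: "linear f" "linear g" "linear ?T'"
    using orth g(1) by (auto simp: orthogonal_transformation_def intro!: linearI simp: algebra_simps)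
  have gv: "g v \<bullet> g x = v \<bullet> x" for x
    using g(1) by (simp add: orthogonal_transformation_def)
  have "?T = f \<circ> (?T' \<circ> g)"
  proof
    fix x
    have "f (?T' (g x)) = f (g x) + (v \<bullet> x) *\<^sub>R f ?a"
      unfolding gv by (simp only: linear_add[OF lin(1)] linear_scale[OF lin(1)])
    then show "?T x = (f \<circ> (?T' \<circ> g)) x" by (simp only: fg fa o_apply)
  qed
  then have "det (matrix ?T) = det (matrix f) * (det (matrix ?T') * det (matrix g))"
    using lin by (simp add: matrix_compose linear_compose det_mul del: o_apply)
  also have "det (matrix f) * det (matrix g) = 1"
    using lin g(2) by (metis det_mul matrix_compose matrix_id_mat_1 det_I)
  then have "det (matrix f) * (det (matrix ?T') * det (matrix g)) = det (matrix ?T')"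
    by (simp add: mult.left_commute)
  also have "matrix ?T' = (\<chi> i. if i = k then \<Sum>j\<in>UNIV. r $ j *s row j (mat 1) else row i (mat 1))"
  proof -
    have row: "row j (mat 1) = (axis j 1 :: real^'n)" for j
      by (auto simp: vec_eq_iff row_def mat_def axis_def)
    have "matrix ?T' $ i $ j = (if i = k then r else axis i 1) $ j" for i j
      by (simp add: matrix_def r_def inner_axis) (simp add: axis_def)
    then show ?thesis
      unfolding row basis_expansion by (auto simp: vec_eq_iff)
  qed
  also have "det \<dots> = r $ k * det (mat 1 :: real^'n^'n)"
    by (rule cramer_lemma_transpose)
  also have "\<dots> = 1 + g v \<bullet> g u"
    using gf[of ?a] by (simp add: r_def fa inner_axis)
  finally show ?thesis by (simp add: gv)
qed

lemma measure_rank_one_update: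
  fixes u v :: "real ^ 'n" and K :: "(real^'n) set"
  assumes "compact K"
  shows "measure lebesgue ((\<lambda>x. x + (v \<bullet> x) *\<^sub>R u) ` K) = \<bar>1 + v \<bullet> u\<bar> * measure lebesgue K"
proof -
  obtain p :: "'n index \<Rightarrow> 'n" where p: "bij p"
    using finite_same_card_bij[of "UNIV :: 'n index set" "UNIV :: 'n set"] card_index by auto
  define f where "f = (\<lambda>x::real^'n. \<chi> i. x $ p i)"
  note [simp] = reindex_measure_preserving[OF p, folded f_def]
  let ?T = "\<lambda>x. x + (v \<bullet> x) *\<^sub>R u" and ?T' = "\<lambda>y. y + (f v \<bullet> y) *\<^sub>R f u"
  have lin: "linear f"
    unfolding f_def by (rule linearI) (auto simp: vec_eq_iff)
  have inner: "f x \<bullet> f y = x \<bullet> y" for x y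
    unfolding f_def inner_vec_def using sum.reindex_bij_betw[OF p, of "\<lambda>i. x $ i \<bullet> y $ i"] by simp
  have T': "?T' (f x) = f (?T x)" for x
    using lin by (simp add: inner linear_add linear_scale)
  have linT': "linear ?T'" and linT: "linear ?T"
    by (auto intro!: linearI simp: algebra_simps)
  have c: "compact (?T ` K)" "compact (f ` K)"
    using assms linT lin
    by (auto intro!: compact_continuous_image linear_continuous_on simp: linear_conv_bounded_linear)
  have "measure lebesgue (?T ` K) = measure lebesgue (f ` ?T ` K)"
    using c by simp
  also have "f ` ?T ` K = ?T' ` f ` K"
    by (simp add: image_image T')
  also have "measure lebesgue \<dots> = \<bar>1 + f v \<bullet> f u\<bar> * measure lebesgue (f ` K)"
    using linT' c by (simp add: measure_linear_image lmeasurable_compact det_rank_one_update)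
  finally show ?thesis
    using assms by (simp add: inner)
qed

section \<open>Simplices supported at their vertices by the ball\<close>

text \<open>
  Each \<open>b\<close> below is the gradient of the barycentric coordinate of \<open>k\<close>. Since \<open>b\<close> attains its maximum
  over the ball at \<open>k\<close>, the point \<open>k\<close> is the unit vector \<open>b / \<bar>b\<bar>\<close>, so \<open>\<bar>b\<bar> (k \<bullet> j - 1) = -1\<close> for all other
  \<open>j\<close>. This is symmetric in \<open>j\<close> and \<open>k\<close> up to the factors \<open>\<bar>b\<bar>\<close>, which are therefore equal. Hence
  distinct points have a common inner product, and the points have a common inner product with their
  sum. A hyperplane containing points that affinely span the space has normal vector zero, and
  that normal vector is the sum.
\<close>
lemma supporting_barycentric_imp_regular:
  fixes Z :: "'a::euclidean_space set"
  assumes "finite Z" "card Z \<ge> 2" "affine hull Z = UNIV" "Z \<subseteq> cball 0 1"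
    and bary: "\<And>k. k \<in> Z \<Longrightarrow> \<exists>b. (\<forall>j\<in>Z - {k}. b \<bullet> (j - k) = -1) \<and> (\<forall>w\<in>cball 0 1. b \<bullet> w \<le> b \<bullet> k)"
  shows "\<forall>z\<in>Z. norm z = 1" and "\<Sum>Z = 0"
proof -
  \<comment> \<open>The witness \<open>s\<close> is the norm of the gradient \<open>b\<close> at \<open>k\<close>.\<close>
  have ex: "\<exists>s. norm k = 1 \<and> (\<forall>j\<in>Z - {k}. s * (k \<bullet> j - 1) = -1)" if k: "k \<in> Z" for k
  proof -
    obtain b where b: "\<forall>j\<in>Z - {k}. b \<bullet> (j - k) = -1" and max: "\<forall>w\<in>cball 0 1. b \<bullet> w \<le> b \<bullet> k"
      using bary[OF k] by blast
    have "Z - {k} \<noteq> {}"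
      using assms(2) k card_mono[of "{k}" Z] by auto
    with b have "b \<noteq> 0" by auto
    then have nb: "norm b > 0" by simp
    have nk: "norm k \<le> 1" using assms(4) k by auto
    have "b \<bullet> (b /\<^sub>R norm b) \<le> b \<bullet> k"
      using max nb by (intro bspec[OF max]) auto
    then have "norm b \<le> b \<bullet> k"
      using nb by (simp add: power2_norm_eq_inner[symmetric] power2_eq_square field_simps)
    moreover have "b \<bullet> k \<le> norm b * norm k"
      by (rule norm_cauchy_schwarz)
    moreover have "norm b * norm k \<le> norm b * 1"
      by (rule mult_left_mono[OF nk]) simp
    ultimately have eq: "b \<bullet> k = norm b * norm k" "norm b * norm k = norm b * 1" by linarith+
    then have n1: "norm k = 1" using nb by simp
    have bk: "b = norm b *\<^sub>R k"
      using eq(1) n1 norm_cauchy_schwarz_eq[of b k] by simp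
    have "norm b * (k \<bullet> j - 1) = -1" if "j \<in> Z - {k}" for j
    proof -
      have "norm b * (k \<bullet> j - 1) = (norm b *\<^sub>R k) \<bullet> (j - k)"
        using n1 by (simp add: inner_diff_right norm_eq_1 algebra_simps)
      then show ?thesis using b that bk by simp
    qed
    then show ?thesis using n1 by blast
  qed
  then show norm1: "\<forall>z\<in>Z. norm z = 1" by blast
  from ex obtain s where s: "\<And>k j. k \<in> Z \<Longrightarrow> j \<in> Z - {k} \<Longrightarrow> s k * (k \<bullet> j - 1) = -1"
    by metis
  have s_eq: "s j = s k" if "j \<in> Z" "k \<in> Z" for j k
  proof (cases "j = k")
    case False
    then have "s k * (k \<bullet> j - 1) = -1" "s j * (k \<bullet> j - 1) = -1"
      using s[of k j] s[of j k] that by (auto simp: inner_commute)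
    then show ?thesis by (metis mult_cancel_right mult_zero_right zero_neq_neg_one)
  qed simp
  obtain k0 where k0: "k0 \<in> Z" using assms(2) by fastforce
  define \<rho> where "\<rho> = 1 - 1 / s k0"
  have gram: "k \<bullet> j = \<rho>" if "k \<in> Z" "j \<in> Z" "j \<noteq> k" for j k
  proof -
    have e: "s k0 * (k \<bullet> j - 1) = -1"
      using s[of k j] that s_eq[OF that(1) k0] by simp
    then have "s k0 \<noteq> 0" by auto
    with e show ?thesis by (simp add: \<rho>_def field_simps)
  qed
  have const: "\<Sum>Z \<bullet> k = 1 + real (card Z - 1) * \<rho>" if "k \<in> Z" for k
  proof -
    have "\<Sum>Z \<bullet> k = (\<Sum>j\<in>Z. j \<bullet> k)" by (simp add: inner_sum_left)
    also have "\<dots> = k \<bullet> k + (\<Sum>j\<in>Z - {k}. j \<bullet> k)"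
      using assms(1) that by (rule sum.remove)
    also have "(\<Sum>j\<in>Z - {k}. j \<bullet> k) = (\<Sum>j\<in>Z - {k}. \<rho>)"
      by (rule sum.cong) (use gram that in auto)
    finally show ?thesis using norm1 that by (simp add: norm_eq_1)
  qed
  define r where "r = 1 + real (card Z - 1) * \<rho>"
  have "affine hull Z \<subseteq> {x. \<Sum>Z \<bullet> x = r}"
    by (rule hull_minimal) (use const r_def affine_hyperplane in auto)
  then have all: "\<Sum>Z \<bullet> x = r" for x using assms(3) by auto
  have "r = 0" using all[of 0] by (simp only: inner_zero_right)
  with all[of "\<Sum>Z"] show "\<Sum>Z = 0" by (simp only: inner_eq_zero_iff)
qed

text \<open>
  The affine function \<open>\<lambda>x. 1 + a \<bullet> (x - k)\<close> is one at \<open>k\<close> and zero at the other points, so \<open>a\<close> is the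
  gradient of the barycentric coordinate of \<open>k\<close>.
\<close>
lemma barycentric_gradient:
  fixes C :: "'a::euclidean_space set"
  assumes "\<not> affine_dependent C" "k \<in> C"
  obtains a where "\<And>x. x \<in> C - {k} \<Longrightarrow> a \<bullet> (x - k) = -1"
proof -
  have "independent ((\<lambda>x. - k + x) ` (C - {k}))"
    using affine_dependent_iff_dependent[of k "C - {k}"] assms by (simp add: insert_absorb)
  then obtain f :: "'a \<Rightarrow> real" where f: "linear f" "\<forall>y\<in>(\<lambda>x. - k + x) ` (C - {k}). f y = -1"
    using linear_independent_extend[of _ "\<lambda>_. -1"] by metis
  have "f y = adjoint f 1 \<bullet> y" for y
    using adjoint_works[OF f(1), of y 1] by (simp add: inner_commute)
  with f(2) show ?thesis by (intro that[of "adjoint f 1"]) auto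
qed


section \<open>Minimal ellipsoids of simplices\<close>

lemma ellipsoid_affine_preimage:
  fixes A M :: "real^'n^'n"
  assumes "invertible A" "invertible M"
  obtains E' where "ellipsoid E'" "compact E'" "convex E'"
    "\<And>x. x \<in> E' \<longleftrightarrow> M *v x + d \<in> (\<lambda>x. c + A *v x) ` cball 0 1"
proof -
  obtain N where N: "N ** M = mat 1" "M ** N = mat 1"
    using assms(2) unfolding invertible_def by auto
  have MN: "M *v (N *v x) = x" and NM: "N *v (M *v x) = x" for x
    using N by (simp_all add: matrix_vector_mul_assoc)
  define E' where "E' = (\<lambda>x. N *v (c - d) + (N ** A) *v x) ` cball 0 1"
  show thesis
  proof (rule that[of E'])
    have "invertible N" using N unfolding invertible_def by auto
    then show "ellipsoid E'"
      unfolding ellipsoid_def E'_def using assms(1) invertible_mult by blast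
    show "compact E'"
      unfolding E'_def
      by (intro compact_continuous_image continuous_intros linear_continuous_on_compose[OF continuous_on_id]) auto
    have "E' = (+) (N *v (c - d)) ` (*v) (N ** A) ` cball 0 1"
      unfolding E'_def by (simp add: image_image)
    then show "convex E'"
      by (simp add: convex_translation convex_linear_image)
    show "x \<in> E' \<longleftrightarrow> M *v x + d \<in> (\<lambda>x. c + A *v x) ` cball 0 1" for x
    proof -
      have "x = N *v (c - d) + (N ** A) *v y \<longleftrightarrow> M *v x + d = c + A *v y" for y
      proof
        assume "x = N *v (c - d) + (N ** A) *v y"
        then show "M *v x + d = c + A *v y"
          by (simp add: matrix_vector_right_distrib matrix_vector_mul_assoc[symmetric] MN)
      next
        assume "M *v x + d = c + A *v y"
        then have "M *v x = (c - d) + A *v y" by (simp add: algebra_simps)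
        then have "N *v (M *v x) = N *v ((c - d) + A *v y)" by (rule arg_cong)
        then show "x = N *v (c - d) + (N ** A) *v y"
          by (simp add: NM matrix_vector_right_distrib matrix_vector_mul_assoc[symmetric])
      qed
      then show ?thesis unfolding E'_def by (auto simp: image_iff)
    qed
  qed
qed

lemma ellipsoid_measure_pos:
  assumes "ellipsoid E"
  shows "measure lebesgue E > 0"
proof -
  obtain A :: "real^'a^'a" and c where A: "invertible A" and E: "E = (\<lambda>x. c + A *v x) ` cball 0 1"
    using assms unfolding ellipsoid_def by auto
  have cE: "compact E"
    unfolding E
    by (intro compact_continuous_image continuous_intros linear_continuous_on_compose[OF continuous_on_id]) auto
  have "surj ((*v) A)"
    using A by (simp add: invertible_eq_bij bij_is_surj)
  then have op: "open ((+) c ` (*v) A ` ball 0 1)"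
    by (intro open_translation open_surjective_linear_image) auto
  have "c + A *v 0 \<in> (+) c ` (*v) A ` ball 0 1"
    by (intro imageI) simp
  then have "c \<in> (+) c ` (*v) A ` ball 0 1" by simp
  with op obtain e where e: "e > 0" "ball c e \<subseteq> (+) c ` (*v) A ` ball 0 1"
    using open_contains_ball by blast
  have "ball c e \<subseteq> E"
    using e(2) unfolding E by (force simp: image_image)
  then have "measure lebesgue (ball c e) \<le> measure lebesgue E"
    using cE by (intro measure_mono_fmeasurable) (auto simp: lmeasurable_compact)
  moreover have "measure lebesgue (ball c e) > 0"
    using content_ball_pos[OF e(1), of c] by simp
  ultimately show ?thesis by linarith
qed

text \<open>
  The functional \<open>a\<close> is the gradient of the barycentric coordinate of \<open>k\<close>. If a point \<open>w\<close> of \<open>E\<close> had a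
  larger value than \<open>k\<close>, then the affine map that sends \<open>k\<close> to \<open>w\<close> and fixes the other vertices
  would have determinant \<open>1 + a \<bullet> (w - k) > 1\<close> and keep all vertices in \<open>E\<close>. The preimage of \<open>E\<close> would
  be an ellipsoid around the simplex that is smaller than \<open>E\<close>.
\<close>
lemma minimal_ellipsoid_supported_at_vertex:
  fixes C :: "(real^'n) set"
  assumes min: "minimal_ellipsoid (convex hull C) E" and "k \<in> C" "w \<in> E"
    and a: "\<And>x. x \<in> C - {k} \<Longrightarrow> a \<bullet> (x - k) = -1"
  shows "a \<bullet> w \<le> a \<bullet> k"
proof (rule ccontr)
  assume "\<not> a \<bullet> w \<le> a \<bullet> k"
  define u where "u = w - k"
  have pos: "a \<bullet> u > 0"
    using \<open>\<not> a \<bullet> w \<le> a \<bullet> k\<close> by (simp add: u_def inner_diff_right)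
  \<comment> \<open>The map \<open>\<lambda>x. ?T x + d\<close> is \<open>\<lambda>x. x + (1 + a \<bullet> (x - k)) *\<^sub>R (w - k)\<close>, split into its linear and its
     constant part.\<close>
  define d where "d = (1 - a \<bullet> k) *\<^sub>R u"
  let ?T = "\<lambda>x. x + (a \<bullet> x) *\<^sub>R u"
  have lin: "linear ?T" by (auto intro!: linearI simp: algebra_simps)
  have M: "matrix ?T *v x = ?T x" for x
    using fun_cong[OF matrix_vector_mul(2)[OF lin]] .
  obtain A :: "real^'n^'n" and c where A: "invertible A" and E: "E = (\<lambda>x. c + A *v x) ` cball 0 1"
    using min unfolding minimal_ellipsoid_def ellipsoid_def by blast
  have inv: "invertible (matrix ?T)"
    using pos by (simp add: invertible_det_nz det_rank_one_update)
  obtain E' where E': "ellipsoid E'" "compact E'" "convex E'"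
    and mem: "\<And>x. x \<in> E' \<longleftrightarrow> ?T x + d \<in> E"
    using ellipsoid_affine_preimage[OF A inv, of d c] unfolding M E by blast
  have CE: "C \<subseteq> E"
    using min hull_subset[of C convex] unfolding minimal_ellipsoid_def by blast
  have "x \<in> E'" if x: "x \<in> C" for x
  proof (cases "x = k")
    case True
    have "?T k + d = w" by (simp add: d_def u_def algebra_simps)
    then show ?thesis using True mem \<open>w \<in> E\<close> by simp
  next
    case False
    then have ax: "a \<bullet> x = a \<bullet> k - 1"
      using a[of x] x by (simp add: inner_diff_right)
    have fixed: "?T x + d = x" unfolding d_def ax by (simp add: algebra_simps)
    show ?thesis using x CE unfolding mem fixed by blast
  qed
  then have "convex hull C \<subseteq> E'"
    using E'(3) by (intro hull_minimal) auto
  then have le: "measure lebesgue E \<le> measure lebesgue E'"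
    using min E'(1) unfolding minimal_ellipsoid_def by blast
  have onto: "y \<in> (\<lambda>x. ?T x + d) ` E'" if "y \<in> E" for y
  proof -
    have "surj ((*v) (matrix ?T))"
      using inv unfolding invertible_eq_bij by (rule bij_is_surj)
    then obtain x where "y - d = matrix ?T *v x" by (rule surjE)
    then have "y = ?T x + d" unfolding M by (simp add: diff_eq_eq)
    then show ?thesis using mem that by (intro image_eqI[of _ _ x]) simp_all
  qed
  have "E = (+) d ` ?T ` E'"
    using onto mem by (auto simp: image_image add.commute)
  then have "measure lebesgue E = measure lebesgue (?T ` E')"
    by (simp add: measure_translation)
  also have "\<dots> = (1 + a \<bullet> u) * measure lebesgue E'"
    using measure_rank_one_update[OF E'(2)] pos by simp
  also have "\<dots> > measure lebesgue E'"
    using pos ellipsoid_measure_pos[OF E'(1)] by (simp add: distrib_right)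
  finally show False using le by linarith
qed

text \<open>
  Pulling everything back by the affine map that parametrises \<open>E\<close> turns \<open>E\<close> into the unit ball and \<open>C\<close>
  into a simplex with barycentric coordinates maximised over the ball at their vertices. Such a
  simplex is inscribed in the sphere and has centroid zero.
\<close>
lemma minimal_ellipsoid_vertices_and_centre:
  fixes C :: "(real^'n) set"
  assumes min: "minimal_ellipsoid (convex hull C) E"
    and C: "\<not> affine_dependent C" "card C = Suc CARD('n)"
  obtains A :: "real^'n^'n" and c where "invertible A" "E = (\<lambda>x. c + A *v x) ` cball 0 1"
    "c = (\<Sum>C) /\<^sub>R card C" "\<And>x. x \<in> C \<Longrightarrow> \<exists>z. norm z = 1 \<and> x = c + A *v z"
proof -
  obtain A :: "real^'n^'n" and c where A: "invertible A" and E: "E = (\<lambda>x. c + A *v x) ` cball 0 1"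
    using min unfolding minimal_ellipsoid_def ellipsoid_def by blast
  obtain N where N: "N ** A = mat 1" "A ** N = mat 1"
    using A unfolding invertible_def by auto
  have AN: "A *v (N *v x) = x" and NA: "N *v (A *v x) = x" for x
    using N by (simp_all add: matrix_vector_mul_assoc)
  define q where "q = (\<lambda>x. N *v (x - c))"
  have q: "c + A *v q x = x" for x by (simp add: q_def AN)
  have q': "q (c + A *v z) = z" for z by (simp add: q_def NA)
  have "inj q" using q by (metis injI)
  define Z where "Z = q ` C"
  have finC: "finite C" using C(1) by (rule aff_independent_finite)
  have cardZ: "card Z = Suc CARD('n)"
    unfolding Z_def using C(2) \<open>inj q\<close> by (metis card_image inj_on_subset subset_UNIV)
  have CE: "C \<subseteq> E"
    using min hull_subset[of C convex] unfolding minimal_ellipsoid_def by blast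
  have "Z = (*v) N ` ((\<lambda>x. x - c) ` C)"
    by (simp add: Z_def q_def image_image)
  moreover have "inj ((*v) N)" using AN by (metis injI)
  ultimately have "aff_dim Z = aff_dim C"
    by (simp add: aff_dim_injective_linear_image aff_dim_translation_eq_subtract)
  then have hull: "affine hull Z = UNIV"
    using aff_dim_affine_independent[OF C(1)] C(2) by (simp flip: aff_dim_eq_full)
  have Zball: "Z \<subseteq> cball 0 1"
    using CE q' unfolding Z_def E by auto
  have supp: "\<exists>b. (\<forall>j\<in>Z - {z}. b \<bullet> (j - z) = -1) \<and> (\<forall>w\<in>cball 0 1. b \<bullet> w \<le> b \<bullet> z)"
    if "z \<in> Z" for z
  proof -
    obtain k where k: "k \<in> C" "z = q k" using \<open>z \<in> Z\<close> by (auto simp: Z_def)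
    obtain a where a: "\<And>x. x \<in> C - {k} \<Longrightarrow> a \<bullet> (x - k) = -1"
      using barycentric_gradient[OF C(1) k(1)] by blast
    have diff: "(a v* A) \<bullet> (x - y) = a \<bullet> ((c + A *v x) - (c + A *v y))" for x y
      by (simp add: dot_lmul_matrix matrix_vector_mult_diff_distrib)
    show ?thesis
    proof (intro exI[of _ "a v* A"] conjI ballI)
      fix j assume "j \<in> Z - {z}"
      then obtain x where "x \<in> C - {k}" "j = q x" using k by (auto simp: Z_def)
      then show "(a v* A) \<bullet> (j - z) = -1" using a k(2) by (simp only: diff q)
    next
      fix w :: "real^'n" assume "w \<in> cball 0 1"
      then have "c + A *v w \<in> E" unfolding E by auto
      then have "a \<bullet> (c + A *v w) \<le> a \<bullet> k"
        using minimal_ellipsoid_supported_at_vertex[OF min k(1) _ a] by blast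
      then have "(a v* A) \<bullet> (w - z) \<le> 0"
        unfolding k(2) diff q by (simp add: inner_diff_right)
      then show "(a v* A) \<bullet> w \<le> (a v* A) \<bullet> z" by (simp add: inner_diff_right)
    qed
  qed
  have "finite Z" "card Z \<ge> 2"
    using finC cardZ by (auto simp: Z_def)
  note reg = supporting_barycentric_imp_regular[OF this hull Zball supp]
  have "\<Sum>C = (\<Sum>z\<in>Z. c + A *v z)"
    unfolding Z_def using \<open>inj q\<close> q by (subst sum.reindex) (auto intro: inj_on_subset)
  also have "\<dots> = card Z *\<^sub>R c + A *v \<Sum>Z"
    by (simp add: sum.distrib sum_constant_scaleR linear_sum[OF matrix_vector_mul_linear]
        del: sum_constant)
  finally have "\<Sum>C = card C *\<^sub>R c"
    using reg(2) cardZ C(2) by simp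
  then have "c = (\<Sum>C) /\<^sub>R card C" using C(2) by simp
  moreover have "\<exists>z. norm z = 1 \<and> x = c + A *v z" if "x \<in> C" for x
    using reg(1) that q by (intro exI[of _ "q x"]) (auto simp: Z_def)
  ultimately show thesis using A E that by blast
qed

lemma frontier_ellipsoid:
  fixes A :: "real^'n^'n"
  assumes "invertible A"
  shows "frontier ((\<lambda>x. c + A *v x) ` cball 0 1) = (\<lambda>x. c + A *v x) ` sphere 0 1"
proof -
  have b: "bij ((*v) A)" using assms by (simp add: invertible_eq_bij)
  have i: "interior ((*v) A ` cball 0 1) = (*v) A ` ball 0 1"
    using b by (subst interior_bijective_linear_image) auto
  have k: "closure ((*v) A ` cball 0 1) = (*v) A ` cball 0 1"
    using b by (subst closure_injective_linear_image[symmetric]) (auto simp: bij_is_inj)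
  have "frontier ((*v) A ` cball 0 1) = (*v) A ` (cball 0 1 - ball 0 1)"
    unfolding frontier_def i k using b by (simp add: image_set_diff bij_is_inj)
  also have "cball 0 1 - ball 0 1 = (sphere 0 1 :: (real^'n) set)" by auto
  finally show ?thesis
    using frontier_translation[of c "(*v) A ` cball 0 1"] by (simp add: image_image)
qed

section \<open>Antipodes of the vertices\<close>

text \<open>Reflection in the centroid preserves the sum of the squared norms of the points.\<close>
lemma reflection_of_some_point_in_ball:
  fixes C :: "'a::real_inner set"
  assumes "finite C" "C \<noteq> {}" "C \<subseteq> cball 0 1"
  shows "\<exists>g\<in>C. norm (2 *\<^sub>R ((\<Sum>C) /\<^sub>R card C) - g) \<le> 1"
proof (rule ccontr)
  assume none: "\<not> ?thesis"
  define c where "c = (\<Sum>C) /\<^sub>R card C"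
  have far: "norm (2 *\<^sub>R c - g) > 1" if "g \<in> C" for g
    using none that by (auto simp: c_def not_le)
  have sum: "\<Sum>C = card C *\<^sub>R c" using assms by (simp add: c_def)
  have "(\<Sum>g\<in>C. (norm (2 *\<^sub>R c - g))\<^sup>2) = (\<Sum>g\<in>C. 4 * (c \<bullet> c) - 4 * (c \<bullet> g) + (norm g)\<^sup>2)"
    by (rule sum.cong) (auto simp: power2_norm_eq_inner inner_diff_left inner_diff_right inner_commute)
  also have "\<dots> = 4 * (card C * (c \<bullet> c)) - 4 * (c \<bullet> \<Sum>C) + (\<Sum>g\<in>C. (norm g)\<^sup>2)"
    by (simp add: sum.distrib sum_subtractf inner_sum_right sum_distrib_left)
  also have "\<dots> = (\<Sum>g\<in>C. (norm g)\<^sup>2)" by (simp add: sum)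
  also have "\<dots> \<le> (\<Sum>g\<in>C. 1)"
    using assms(3) by (intro sum_mono) (auto simp: power_le_one)
  also have "\<dots> < (\<Sum>g\<in>C. (norm (2 *\<^sub>R c - g))\<^sup>2)"
    using assms far by (intro sum_strict_mono) (auto simp: one_less_power)
  finally show False by simp
qed

theorem theorem4:
  fixes S :: "(real ^ 'n) set"
  assumes "CARD('n) \<ge> 2"
    and "int CARD('n) simplex S"
    and "S \<subseteq> cball 0 1"
  shows "\<exists>g\<in>vertices S. \<forall>E h y.
           minimal_ellipsoid S E \<and>
           h = center_of_gravity (opposite_face S g) \<and>
           y \<in> frontier E \<and> (\<exists>t>0. y = g + t *\<^sub>R (h - g))
           \<longrightarrow> y \<in> cball 0 1"
proof -
  obtain C where C: "\<not> affine_dependent C" "int (card C) = int CARD('n) + 1" and S: "S = convex hull C"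
    using assms(2) unfolding simplex_def by blast
  have card: "card C = Suc CARD('n)" using C(2) by linarith
  have fin: "finite C" using C(1) by (rule aff_independent_finite)
  have vertices_hull: "vertices (convex hull D) = D" if "D \<subseteq> C" for D
    using extreme_point_of_convex_hull_affine_independent affine_independent_subset[OF C(1) that]
    by (auto simp: vertices_def)
  define c where "c = (\<Sum>C) /\<^sub>R card C"
  have "C \<subseteq> cball 0 1" using assms(3) hull_subset[of C convex] S by blast
  then obtain g where g: "g \<in> C" "norm (2 *\<^sub>R c - g) \<le> 1"
    using reflection_of_some_point_in_ball[of C] fin card unfolding c_def by fastforce
  have sumC: "\<Sum>C = (CARD('n) + 1) *\<^sub>R c" using card by (simp add: c_def)
  have h: "center_of_gravity (opposite_face S g) - g = ((CARD('n) + 1) / CARD('n)) *\<^sub>R (c - g)"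
  proof -
    have coeff: "(CARD('n) + 1) / CARD('n) = inverse (real CARD('n)) + 1"
      by (simp add: field_simps)
    have "center_of_gravity (opposite_face S g) = (\<Sum>C - g) /\<^sub>R CARD('n)"
      using g(1) fin card vertices_hull[of C] vertices_hull[of "C - {g}"]
      by (simp add: center_of_gravity_def opposite_face_def S sum_diff1)
    also have "\<dots> - g = ((CARD('n) + 1) / CARD('n)) *\<^sub>R (c - g)"
      unfolding sumC coeff by (simp add: scaleR_diff_right scaleR_left_distrib scaleR_add_right)
    finally show ?thesis .
  qed
  show ?thesis
  proof (intro bexI[of _ g] allI impI; (elim conjE exE)?)
    show "g \<in> vertices S" using g vertices_hull[of C] S by simp
    fix E h y t
    assume min: "minimal_ellipsoid S E" and hdef: "h = center_of_gravity (opposite_face S g)"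
      and y: "y \<in> frontier E" and t: "t > 0" "y = g + t *\<^sub>R (h - g)"
    obtain A :: "real^'n^'n" and c' where A: "invertible A" "E = (\<lambda>x. c' + A *v x) ` cball 0 1"
      and c': "c' = (\<Sum>C) /\<^sub>R card C" and sph: "\<And>x. x \<in> C \<Longrightarrow> \<exists>z. norm z = 1 \<and> x = c' + A *v z"
      using minimal_ellipsoid_vertices_and_centre[OF min[unfolded S] C(1) card] by blast
    have cc: "c' = c" by (simp add: c' c_def)
    obtain z where z: "norm z = 1" "g = c + A *v z" using sph[OF g(1)] cc by auto
    obtain v where v: "norm v = 1" "y = c + A *v v"
      using y frontier_ellipsoid[OF A(1), of c] unfolding A(2) cc by auto
    \<comment> \<open>The line through \<open>g\<close> and \<open>h\<close> is also the line through \<open>g\<close> and \<open>c\<close>; \<open>s\<close> is the parameter of \<open>y\<close>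
       on it when \<open>c\<close> has parameter 1, so the line meets the boundary of \<open>E\<close> at 0 and 2.\<close>
    define s where "s = t * ((CARD('n) + 1) / CARD('n))"
    have s: "s > 0" using t(1) by (simp add: s_def)
    have ys: "y = g + s *\<^sub>R (c - g)"
      by (simp only: t(2) hdef h s_def scaleR_scaleR)
    have "A *v v = A *v ((1 - s) *\<^sub>R z)"
      using ys v(2) z(2) by (simp add: algebra_simps matrix_vector_mult_scaleR)
    then have "v = (1 - s) *\<^sub>R z"
      using A(1) by (metis invertible_eq_bij bij_is_inj injD)
    then have "\<bar>1 - s\<bar> = 1" using v(1) z(1) by simp
    then have "s = 2" using s by linarith
    then have "y = 2 *\<^sub>R c - g" using ys by (simp add: algebra_simps scaleR_2)
    then show "y \<in> cball 0 1" using g(2) by simp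
  qed
qed

end
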